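(* Let $G$ be a graph on $n$ vertices and $k\ge 1$ an integer. Then $G$ or its complement $\overline{G}$ has a minor $H$ with $\Delta(H)\ge n-k$ if and only if $\min(\gamma_c(G),\gamma_c(\overline{G}))\le k$.
   Context: All graphs are finite, simple and undirected; $\overline{G}$ denotes the complement of $G$. A minor of $G$ is a graph obtained from $G$ by a sequence of vertex deletions, edge deletions and edge contractions. $\Delta(H)$ is the maximum degree of $H$. A set $S\subseteq V(G)$ is dominating if every vertex outside $S$ is adjacent to some vertex of $S$. The connected domination number $\gamma_c(G)$ is the minimum cardinality of a dominating set $S$ whose induced subgraph $G[S]$ is connected (for a disconnected graph no such set exists, and $\gamma_c$ is taken to be $\infty$). *)

theory Defs
  imports "Graph_Theory.Digraph_Component" "HOL-Library.Extended_Nat"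
begin

text \<open>
  A finite simple undirected graph is a \<^locale>\<open>pair_graph\<close>: a finite, loopfree, symmetric digraph
  without parallel arcs. An undirected edge corresponds to the two arcs \<open>(u, v)\<close> and \<open>(v, u)\<close>,
  so the degree of a vertex is its \<^const>\<open>out_degree\<close>.
\<close>

definition complement :: "'a pair_pre_digraph \<Rightarrow> 'a pair_pre_digraph" where
  "complement G = \<lparr> pverts = pverts G,
     parcs = {(u, v). u \<in> pverts G \<and> v \<in> pverts G \<and> u \<noteq> v \<and> (u, v) \<notin> parcs G} \<rparr>"

definition delete_vertex :: "'a pair_pre_digraph \<Rightarrow> 'a \<Rightarrow> 'a pair_pre_digraph" where
  "delete_vertex G v = \<lparr> pverts = pverts G - {v},
     parcs = {e \<in> parcs G. fst e \<noteq> v \<and> snd e \<noteq> v} \<rparr>"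

definition delete_edge :: "'a pair_pre_digraph \<Rightarrow> 'a \<Rightarrow> 'a \<Rightarrow> 'a pair_pre_digraph" where
  "delete_edge G u v = \<lparr> pverts = pverts G, parcs = parcs G - {(u, v), (v, u)} \<rparr>"

text \<open>
  The vertex resulting from the contraction of \<open>uv\<close> keeps the name \<open>u\<close>. Subtracting \<^const>\<open>Id\<close>
  removes the loop that arises from \<open>uv\<close>; parallel edges are merged because arcs form a set.
\<close>

definition contract_edge :: "'a pair_pre_digraph \<Rightarrow> 'a \<Rightarrow> 'a \<Rightarrow> 'a pair_pre_digraph" where
  "contract_edge G u v =
     (let f = (\<lambda>x. if x = v then u else x)
      in \<lparr> pverts = pverts G - {v}, parcs = map_prod f f ` parcs G - Id \<rparr>)"

inductive has_minor :: "'a pair_pre_digraph \<Rightarrow> 'a pair_pre_digraph \<Rightarrow> bool" for G where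
  minor_refl: "has_minor G G"
| minor_delete_vertex: "has_minor G H \<Longrightarrow> v \<in> pverts H \<Longrightarrow> has_minor G (delete_vertex H v)"
| minor_delete_edge: "has_minor G H \<Longrightarrow> (u, v) \<in> parcs H \<Longrightarrow> has_minor G (delete_edge H u v)"
| minor_contract_edge: "has_minor G H \<Longrightarrow> (u, v) \<in> parcs H \<Longrightarrow> has_minor G (contract_edge H u v)"

definition max_degree :: "'a pair_pre_digraph \<Rightarrow> nat" where
  "max_degree G = (if pverts G = {} then 0 else Max (out_degree (with_proj G) ` pverts G))"

definition dominating :: "'a pair_pre_digraph \<Rightarrow> 'a set \<Rightarrow> bool" where
  "dominating G S \<longleftrightarrow> S \<subseteq> pverts G \<and> (\<forall>v \<in> pverts G - S. \<exists>u \<in> S. (v, u) \<in> parcs G)"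

text \<open>
  \<^const>\<open>Digraph_Component.connected\<close> is false for the graph without vertices. The disjunct
  \<open>S = {}\<close> only matters for that graph, since no other graph is dominated by the empty set; it makes
  the connected domination number of the graph without vertices \<open>0\<close>.
\<close>

definition connected_dominating :: "'a pair_pre_digraph \<Rightarrow> 'a set \<Rightarrow> bool" where
  "connected_dominating G S \<longleftrightarrow>
     dominating G S \<and> (S = {} \<or> Digraph_Component.connected (with_proj G \<restriction> S))"

text \<open>The infimum of the empty set in \<^typ>\<open>enat\<close> is \<open>\<infinity>\<close>.\<close>

definition connected_domination_number :: "'a pair_pre_digraph \<Rightarrow> enat" where
  "connected_domination_number G = (INF S \<in> {S. connected_dominating G S}. enat (card S))"

lemma pair_graph_iff:
  "pair_graph G \<longleftrightarrow> finite (pverts G) \<and> parcs G \<subseteq> pverts G \<times> pverts G \<and> sym (parcs G) \<and> irrefl (parcs G)"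
proof
  assume "pair_graph G"
  then interpret pair_graph G .
  show "finite (pverts G) \<and> parcs G \<subseteq> pverts G \<times> pverts G \<and> sym (parcs G) \<and> irrefl (parcs G)"
    using pair_finite_verts in_arcsD1 in_arcsD2 arcs_symmetric no_loops'
    by (metis irreflI subrelI mem_Sigma_iff symI)
next
  assume *: "finite (pverts G) \<and> parcs G \<subseteq> pverts G \<times> pverts G \<and> sym (parcs G) \<and> irrefl (parcs G)"
  then have "finite (parcs G)"
    using finite_subset by blast
  with * show "pair_graph G"
    by unfold_locales (auto simp: symmetric_def irrefl_def)
qed

lemma pair_graph_complement: "pair_graph G \<Longrightarrow> pair_graph (complement G)"
  by (auto simp: pair_graph_iff complement_def sym_def irrefl_def)

lemma complement_complement: "pair_graph G \<Longrightarrow> complement (complement G) = G"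
  by (cases G) (auto simp: pair_graph_iff complement_def irrefl_def)

lemma pair_graph_delete_vertex: "pair_graph G \<Longrightarrow> pair_graph (delete_vertex G v)"
  by (auto simp: pair_graph_iff delete_vertex_def sym_def irrefl_def)

lemma pair_graph_delete_edge: "pair_graph G \<Longrightarrow> pair_graph (delete_edge G u v)"
  by (auto simp: pair_graph_iff delete_edge_def sym_def irrefl_def)

lemma pair_graph_contract_edge:
  assumes "pair_graph G" "(u, v) \<in> parcs G"
  shows "pair_graph (contract_edge G u v)"
proof -
  have "u \<noteq> v" "u \<in> pverts G"
    using assms by (auto simp: pair_graph_iff irrefl_def)
  moreover have "sym (map_prod f f ` parcs G - Id)" for f :: "'a \<Rightarrow> 'a"
    using assms by (force simp: pair_graph_iff sym_def)
  ultimately show ?thesis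
    using assms(1) by (auto simp: pair_graph_iff contract_edge_def Let_def irrefl_def split: if_splits)
qed

lemma pair_graph_minor: "has_minor G H \<Longrightarrow> pair_graph G \<Longrightarrow> pair_graph H"
  by (induction rule: has_minor.induct)
    (auto intro: pair_graph_delete_vertex pair_graph_delete_edge pair_graph_contract_edge)

end

theory Submission
  imports Defs
begin

text \<open>
  A minor vertex of degree \<open>d\<close> yields a connected set \<open>S\<close> of vertices of \<open>G\<close>, its branch set, with
  at least \<open>d\<close> neighbours outside of \<open>S\<close>. If \<open>G\<close> is connected, then moving neighbours of \<open>S\<close> that
  have a neighbour at distance two into \<open>S\<close> never decreases the number of neighbours, and ends with
  a dominating set. If \<open>G\<close> is disconnected, then two vertices from different components
  dominate the complement, which settles \<open>k \<ge> 2\<close>; for \<open>k = 1\<close> the set \<open>S\<close> is already dominating.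
  Conversely, contracting a connected dominating set to one vertex gives a minor with a
  vertex adjacent to all others.
\<close>

subsection \<open>Connected sets of vertices\<close>

text \<open>Stated for a bare relation so that it applies alike to a graph, its complement and its
  contractions. \<open>Restr r S\<close> confines the walks to \<open>S\<close>.\<close>

definition connected_set :: "'a rel \<Rightarrow> 'a set \<Rightarrow> bool" where
  "connected_set r S \<longleftrightarrow> S \<noteq> {} \<and> (\<forall>u\<in>S. \<forall>v\<in>S. (u, v) \<in> (Restr r S)\<^sup>*)"

lemma connected_set_singleton [simp]: "connected_set r {v}"
  by (auto simp: connected_set_def)

lemma connected_setI_root:
  assumes "sym r" "a \<in> S" "\<And>v. v \<in> S \<Longrightarrow> (a, v) \<in> (Restr r S)\<^sup>*"
  shows "connected_set r S"
proof -
  have "sym ((Restr r S)\<^sup>*)"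
    using assms(1) by (intro sym_rtrancl) (auto simp: sym_def)
  then show ?thesis
    unfolding connected_set_def using assms(2,3) by (meson empty_iff rtrancl_trans symD)
qed

lemma connected_set_Un:
  assumes "sym r" "connected_set r S" "connected_set r T" "s \<in> S" "t \<in> T" "(s, t) \<in> r"
  shows "connected_set r (S \<union> T)"
proof (rule connected_setI_root[OF assms(1)])
  show "s \<in> S \<union> T" using assms by blast
  fix v assume "v \<in> S \<union> T"
  then show "(s, v) \<in> (Restr r (S \<union> T))\<^sup>*"
  proof
    assume "v \<in> S"
    then have "(s, v) \<in> (Restr r S)\<^sup>*" using assms by (auto simp: connected_set_def)
    then show ?thesis by (rule rtrancl_mono[THEN subsetD, rotated]) blast
  next
    assume "v \<in> T"
    then have "(t, v) \<in> (Restr r T)\<^sup>*" using assms by (auto simp: connected_set_def)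
    then have "(t, v) \<in> (Restr r (S \<union> T))\<^sup>*" by (rule rtrancl_mono[THEN subsetD, rotated]) blast
    moreover have "(s, t) \<in> Restr r (S \<union> T)" using assms by blast
    ultimately show ?thesis by (rule converse_rtrancl_into_rtrancl[rotated])
  qed
qed

lemma connected_set_insert:
  assumes "sym r" "connected_set r S" "s \<in> S" "(s, t) \<in> r"
  shows "connected_set r (insert t S)"
  using connected_set_Un[OF assms(1,2) connected_set_singleton assms(3) _ assms(4)] by simp

text \<open>A walk from \<open>A\<close> to a vertex outside must leave \<open>A\<close> at some
  arc. The induction along the walk carries the disjunction that the current end is still in
  \<open>A\<close> or such an arc has been met.\<close>

lemma connected_set_crossing:
  assumes "connected_set r S" "A \<subseteq> S" "A \<noteq> {}" "A \<noteq> S"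
  obtains a b where "a \<in> A" "b \<in> S - A" "(a, b) \<in> r"
proof -
  obtain x y where xy: "x \<in> A" "y \<in> S - A" using assms by blast
  have "(x, y) \<in> (Restr r S)\<^sup>*" using assms(1,2) xy by (auto simp: connected_set_def)
  then have "y \<in> A \<or> (\<exists>a b. a \<in> A \<and> b \<in> S - A \<and> (a, b) \<in> r)"
    by induction (use xy in blast)+
  then show ?thesis using xy that by blast
qed

text \<open>The map \<open>f\<close> sends walks to walks: an arc whose two ends merge becomes a
  stationary step, which the reflexive closure absorbs.\<close>

lemma connected_set_contract:
  assumes "connected_set r S" "u \<in> S" "u \<noteq> v"
  defines "f \<equiv> \<lambda>x. if x = v then u else x"
  shows "connected_set (map_prod f f ` r - Id) (S - {v})"
proof -
  let ?r = "Restr (map_prod f f ` r - Id) (S - {v})"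
  have *: "(f x, f y) \<in> ?r\<^sup>*" if "(x, y) \<in> (Restr r S)\<^sup>*" for x y
    using that
  proof induction
    case (step y z)
    have "(f y, f z) \<in> map_prod f f ` r"
      using step.hyps(2) by (intro rev_image_eqI[of "(y, z)"]) auto
    moreover have "f y \<in> S - {v}" "f z \<in> S - {v}"
      using step.hyps(2) assms by auto
    ultimately have "f y = f z \<or> (f y, f z) \<in> ?r" by auto
    then show ?case using step.IH by (metis rtrancl.rtrancl_into_rtrancl)
  qed simp
  have "(x, y) \<in> ?r\<^sup>*" if "x \<in> S - {v}" "y \<in> S - {v}" for x y
    using *[of x y] that assms(1) by (auto simp: f_def connected_set_def)
  then show ?thesis using assms(2,3) by (auto simp: connected_set_def)
qed

text \<open>Symmetry makes the symmetric closure in the library notion harmless, and for a start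
  vertex in \<open>S\<close> its \<open>rtrancl_on\<close> agrees with the ordinary closure.\<close>

lemma connected_induce_iff:
  assumes "sym (parcs G)"
  shows "Digraph_Component.connected (with_proj G \<restriction> S) \<longleftrightarrow> connected_set (parcs G) S"
proof -
  have ends: "(arcs_ends (with_proj G \<restriction> S))\<^sup>s = Restr (parcs G) S"
    using assms by (auto simp: induce_subgraph_def arcs_ends_conv symcl_def sym_def intro: rev_image_eqI)
  have "(u, v) \<in> rtrancl_on S (Restr (parcs G) S) \<longleftrightarrow> (u, v) \<in> (Restr (parcs G) S)\<^sup>*"
    if "u \<in> S" for u v
  proof
    show "(u, v) \<in> (Restr (parcs G) S)\<^sup>* \<Longrightarrow> (u, v) \<in> rtrancl_on S (Restr (parcs G) S)"
      by (induction rule: rtrancl_induct) (use that in \<open>auto intro: rtrancl_on_into_rtrancl_on\<close>)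
  qed (rule rtrancl_on_rtranclI)
  then show ?thesis
    unfolding connected_conv ends connected_set_def by auto
qed

text \<open>Each enlargement of \<open>S\<close> keeps at least as many outer neighbours, so the
  number for the initial set is at most that for the final one, whose outer neighbours are disjoint
  from it inside \<open>V\<close>. Thus \<open>d\<close> outer neighbours give a connected
  dominating set of at most \<open>card V\<close> minus \<open>d\<close> vertices.\<close>

lemma connected_set_extend_dominating:
  assumes "finite V" "r \<subseteq> V \<times> V" "sym r" "connected_set r V" "connected_set r S" "S \<subseteq> V"
  shows "\<exists>S'. S' \<subseteq> V \<and> connected_set r S' \<and> V \<subseteq> S' \<union> r `` S' \<and> card (r `` S - S) + card S' \<le> card V"
  using assms(5,6)
proof (induction "card (V - S)" arbitrary: S rule: less_induct)
  case less
  let ?N = "r `` S - S"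
  have fin: "finite ?N" "finite S"
    using assms(1,2) less.prems(2) by (auto intro: finite_subset[of _ V])
  show ?case
  proof (cases "V \<subseteq> S \<union> r `` S")
    case True
    have "card ?N + card S = card (?N \<union> S)"
      using fin by (intro card_Un_disjoint[symmetric]) auto
    also have "\<dots> \<le> card V"
      using assms(1,2) less.prems(2) by (intro card_mono) auto
    finally show ?thesis using True less.prems by blast
  next
    case False
    have "S \<union> r `` S \<subseteq> V" "S \<union> r `` S \<noteq> {}" "S \<union> r `` S \<noteq> V"
      using False less.prems assms(2) by (auto simp: connected_set_def)
    from connected_set_crossing[OF assms(4) this] obtain a b
      where ab: "a \<in> S \<union> r `` S" "b \<in> V - (S \<union> r `` S)" "(a, b) \<in> r" by blast
    \<comment> \<open>If \<open>a\<close> were in \<open>S\<close>, then \<open>b\<close> would be a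
      neighbour of \<open>S\<close>.\<close>
    then have a: "a \<in> ?N" by blast
    then obtain s where s: "s \<in> S" "(s, a) \<in> r" by blast
    let ?S = "insert a S"
    have aV: "a \<in> V" using s assms(2) by blast
    have "card (V - ?S) < card (V - S)"
      using assms(1) a aV by (intro psubset_card_mono) auto
    moreover have "connected_set r ?S"
      using connected_set_insert[OF assms(3) less.prems(1)] s by blast
    ultimately obtain S' where S': "S' \<subseteq> V" "connected_set r S'" "V \<subseteq> S' \<union> r `` S'"
      "card (r `` ?S - ?S) + card S' \<le> card V"
      using less.hyps[of ?S] less.prems aV by blast
    \<comment> \<open>Moving \<open>a\<close> into the set costs the outer neighbour
      \<open>a\<close> and gains \<open>b\<close>, which was not counted before; the others
      remain.\<close>
    have "card ?N = card (insert b (?N - {a}))"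
      using a ab(2) fin by (simp add: card.remove[of "r `` S - S" a] del: Diff_insert card_Diff_insert)
    also have "\<dots> \<le> card (r `` ?S - ?S)"
      using ab assms(1,2) by (intro card_mono finite_subset[of "r `` ?S - ?S" V]) auto
    finally show ?thesis using S' by (intro exI[of _ S']) auto
  qed
qed

text \<open>Take \<open>u\<close> and \<open>v\<close> with no walk between them. They have no
  common neighbour, so every other vertex is adjacent to one of them in the complement, where
  \<open>u\<close> and \<open>v\<close> are adjacent to each other.\<close>

lemma connected_set_complement_pair:
  assumes "pair_graph G" "pverts G \<noteq> {}" "\<not> connected_set (parcs G) (pverts G)"
  obtains u v where "u \<in> pverts G" "v \<in> pverts G" "connected_set (parcs (complement G)) {u, v}"
    "pverts G \<subseteq> {u, v} \<union> parcs (complement G) `` {u, v}"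
proof -
  have G: "parcs G \<subseteq> pverts G \<times> pverts G" "sym (parcs G)"
    using assms(1) by (auto simp: pair_graph_iff)
  have restr: "Restr (parcs G) (pverts G) = parcs G" using G by auto
  obtain u v where uv: "u \<in> pverts G" "v \<in> pverts G" "(u, v) \<notin> (parcs G)\<^sup>*"
    using assms(2,3) unfolding connected_set_def restr by blast
  have no: "(u, w) \<notin> parcs G \<or> (w, v) \<notin> parcs G" for w
    using uv(3) by (meson r_into_rtrancl rtrancl_trans)
  have "(u, v) \<notin> parcs G" "u \<noteq> v" using uv(3) by auto
  then have adj: "(u, v) \<in> parcs (complement G)"
    using uv by (auto simp: complement_def)
  have "sym (parcs (complement G))"
    using pair_graph_complement[OF assms(1)] by (auto simp: pair_graph_iff)
  from connected_set_insert[OF this connected_set_singleton _ adj]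
  have "connected_set (parcs (complement G)) {u, v}" by (simp add: insert_commute)
  moreover have "pverts G \<subseteq> {u, v} \<union> parcs (complement G) `` {u, v}"
    using uv no G(2) by (auto simp: complement_def sym_def)
  ultimately show ?thesis using that uv by blast
qed

subsection \<open>The connected domination number\<close>

text \<open>A finite bound excludes the empty infimum, which is \<infinity>, and the infimum of a
  nonempty set in \<open>enat\<close> is its least element, hence attained.\<close>

lemma connected_domination_number_le_iff:
  "connected_domination_number G \<le> enat k \<longleftrightarrow> (\<exists>S. connected_dominating G S \<and> card S \<le> k)"
proof
  assume le: "connected_domination_number G \<le> enat k"
  let ?A = "(\<lambda>S. enat (card S)) ` {S. connected_dominating G S}"
  have "?A \<noteq> {}"
  proof
    assume "?A = {}"
    then have "connected_domination_number G = \<infinity>"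
      unfolding connected_domination_number_def by (simp only: Inf_enat_def simp_thms if_True)
    then show False using le by simp
  qed
  then have "connected_domination_number G \<in> ?A"
    unfolding connected_domination_number_def by (metis Inf_enat_def LeastI_ex ex_in_conv)
  then show "\<exists>S. connected_dominating G S \<and> card S \<le> k" using le by auto
next
  assume "\<exists>S. connected_dominating G S \<and> card S \<le> k"
  then show "connected_domination_number G \<le> enat k"
    unfolding connected_domination_number_def by (auto intro: INF_lower2)
qed

lemma connected_dominating_iff:
  assumes "pair_graph G" "S \<noteq> {}"
  shows "connected_dominating G S \<longleftrightarrow>
    S \<subseteq> pverts G \<and> connected_set (parcs G) S \<and> pverts G \<subseteq> S \<union> parcs G `` S"
proof -
  have sym: "sym (parcs G)" using assms(1) by (auto simp: pair_graph_iff)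
  then have "(u, v) \<in> parcs G \<longleftrightarrow> (v, u) \<in> parcs G" for u v by (auto dest: symD)
  then have "dominating G S \<longleftrightarrow> S \<subseteq> pverts G \<and> pverts G \<subseteq> S \<union> parcs G `` S"
    unfolding dominating_def by blast
  then show ?thesis
    using assms(2) by (auto simp: connected_dominating_def connected_induce_iff[OF sym])
qed

subsection \<open>Minors\<close>

text \<open>\<open>has_minor\<close> appends operations at the end, whereas the later induction on a
  dominating set contracts an edge first and then takes a minor of the result.\<close>

lemma has_minor_trans:
  assumes "has_minor H K" "has_minor G H"
  shows "has_minor G K"
  using assms by (induction rule: has_minor.induct) (auto intro: has_minor.intros)

text \<open>\<open>B x\<close> collects the vertices of \<open>G\<close> that have been merged into
  \<open>x\<close>. Deletions leave \<open>B\<close> as it is; only contraction changes it.\<close>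

lemma has_minor_branch_sets:
  assumes "has_minor G H" "pair_graph G"
  obtains B where
    "\<And>x. x \<in> pverts H \<Longrightarrow> B x \<subseteq> pverts G \<and> connected_set (parcs G) (B x)"
    "\<And>x y. x \<in> pverts H \<Longrightarrow> y \<in> pverts H \<Longrightarrow> x \<noteq> y \<Longrightarrow> B x \<inter> B y = {}"
    "\<And>x y. (x, y) \<in> parcs H \<Longrightarrow> \<exists>a\<in>B x. \<exists>b\<in>B y. (a, b) \<in> parcs G"
proof -
  have sym: "sym (parcs G)" using assms(2) by (auto simp: pair_graph_iff)
  from assms(1) have "\<exists>B. (\<forall>x\<in>pverts H. B x \<subseteq> pverts G \<and> connected_set (parcs G) (B x)) \<and>
    (\<forall>x\<in>pverts H. \<forall>y\<in>pverts H. x \<noteq> y \<longrightarrow> B x \<inter> B y = {}) \<and>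
    (\<forall>(x, y)\<in>parcs H. \<exists>a\<in>B x. \<exists>b\<in>B y. (a, b) \<in> parcs G)" (is "\<exists>B. ?P H B")
  proof induction
    case minor_refl
    show ?case by (rule exI[of _ "\<lambda>x. {x}"]) auto
  next
    case (minor_delete_vertex H v)
    then obtain B where "?P H B" by blast
    then have "?P (delete_vertex H v) B" unfolding delete_vertex_def by simp
    then show ?case by blast
  next
    case (minor_delete_edge H u v)
    then obtain B where "?P H B" by blast
    then have "?P (delete_edge H u v) B" unfolding delete_edge_def by simp
    then show ?case by blast
  next
    case (minor_contract_edge H u v)
    then obtain B where B: "?P H B" by blast
    have "pair_graph H"
      using minor_contract_edge.hyps(1) assms(2) by (rule pair_graph_minor)
    then have uv: "u \<in> pverts H" "v \<in> pverts H" "u \<noteq> v"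
      using minor_contract_edge.hyps(2) by (auto simp: pair_graph_iff irrefl_def)
    \<comment> \<open>The merged vertex keeps the name \<open>u\<close>, so \<open>u\<close> takes
      over the branch set of \<open>v\<close>.\<close>
    let ?B = "B(u := B u \<union> B v)"
    let ?f = "\<lambda>x. if x = v then u else x"
    have verts: "pverts (contract_edge H u v) = pverts H - {v}"
      and arcs: "parcs (contract_edge H u v) = map_prod ?f ?f ` parcs H - Id"
      by (auto simp: contract_edge_def Let_def)
    obtain a b where "a \<in> B u" "b \<in> B v" "(a, b) \<in> parcs G"
      using B minor_contract_edge.hyps(2) by blast
    then have "connected_set (parcs G) (B u \<union> B v)"
      using B uv by (intro connected_set_Un[OF sym]) auto
    then have "\<forall>x\<in>pverts H - {v}. ?B x \<subseteq> pverts G \<and> connected_set (parcs G) (?B x)"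
      using B uv by auto
    moreover have "\<forall>x\<in>pverts H - {v}. \<forall>y\<in>pverts H - {v}. x \<noteq> y \<longrightarrow> ?B x \<inter> ?B y = {}"
    proof (intro ballI impI)
      fix x y assume "x \<in> pverts H - {v}" "y \<in> pverts H - {v}" "x \<noteq> y"
      with B uv have "B x \<inter> B y = {}" "B x \<inter> B v = {}" "B v \<inter> B y = {}"
        by blast+
      then show "?B x \<inter> ?B y = {}" using \<open>x \<noteq> y\<close> by auto
    qed
    moreover have "\<forall>(x, y)\<in>map_prod ?f ?f ` parcs H - Id. \<exists>a\<in>?B x. \<exists>b\<in>?B y. (a, b) \<in> parcs G"
    proof -
      \<comment> \<open>Branch sets only grow along \<open>?f\<close>, so the arc of
        \<open>G\<close> that witnessed an arc of \<open>H\<close> still witnesses its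
        image.\<close>
      have "\<exists>a\<in>?B (?f x). \<exists>b\<in>?B (?f y). (a, b) \<in> parcs G" if "(x, y) \<in> parcs H" for x y
      proof -
        have "B x \<subseteq> ?B (?f x)" "B y \<subseteq> ?B (?f y)" by auto
        then show ?thesis using B that by blast
      qed
      then show ?thesis by (auto simp del: fun_upd_apply split del: if_split)
    qed
    ultimately show ?case unfolding verts arcs by blast
  qed
  then obtain B where "?P H B" by blast
  then show ?thesis by (intro that[of B]) auto
qed

section \<open>Large degree in a minor and connected sets of vertices\<close>

lemma out_degree_with_proj: "out_degree (with_proj G) v = card (parcs G `` {v})"
proof -
  have "out_arcs (with_proj G) v = Pair v ` (parcs G `` {v})"
    by (auto simp: out_arcs_def)
  then show ?thesis by (simp add: out_degree_def card_image inj_on_def)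
qed

text \<open>The set is the branch set of a vertex of maximum degree. Its neighbours in the minor
  have disjoint branch sets, so one representative from each gives that many distinct outer
  neighbours.\<close>

lemma has_minor_imp_connected_set:
  assumes "has_minor G H" "pair_graph G" "pverts G \<noteq> {}"
  obtains S where "S \<subseteq> pverts G" "connected_set (parcs G) S" "max_degree H \<le> card (parcs G `` S - S)"
proof (cases "pverts H = {}")
  \<comment> \<open>Here \<open>max_degree H\<close> is 0 by convention, so any single vertex of
    \<open>G\<close> will do.\<close>
  case True
  then show ?thesis using assms(3) that[of "{SOME v. v \<in> pverts G}"]
    by (auto simp: max_degree_def some_in_eq)
next
  case False
  have H: "pair_graph H" using assms(1,2) by (rule pair_graph_minor)
  then have "max_degree H \<in> out_degree (with_proj H) ` pverts H"
    using False by (auto simp: max_degree_def pair_graph_iff intro!: Max_in)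
  then obtain x where x: "x \<in> pverts H" "max_degree H = card (parcs H `` {x})"
    by (auto simp: out_degree_with_proj)
  obtain B where B:
    "\<And>x. x \<in> pverts H \<Longrightarrow> B x \<subseteq> pverts G \<and> connected_set (parcs G) (B x)"
    "\<And>x y. x \<in> pverts H \<Longrightarrow> y \<in> pverts H \<Longrightarrow> x \<noteq> y \<Longrightarrow> B x \<inter> B y = {}"
    "\<And>x y. (x, y) \<in> parcs H \<Longrightarrow> \<exists>a\<in>B x. \<exists>b\<in>B y. (a, b) \<in> parcs G"
    using has_minor_branch_sets[OF assms(1,2)] by blast
  have "\<forall>y\<in>parcs H `` {x}. \<exists>b. b \<in> B y \<and> b \<in> parcs G `` B x"
    using B(3) by blast
  then obtain b where b: "\<And>y. y \<in> parcs H `` {x} \<Longrightarrow> b y \<in> B y \<and> b y \<in> parcs G `` B x"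
    by metis
  have N: "y \<in> pverts H \<and> y \<noteq> x" if "y \<in> parcs H `` {x}" for y
    using that H by (auto simp: pair_graph_iff irrefl_def)
  have "inj_on b (parcs H `` {x})"
    using b N B(2) by (intro inj_onI) (metis disjoint_iff)
  moreover have "b ` (parcs H `` {x}) \<subseteq> parcs G `` B x - B x"
    using b N B(2)[OF x(1)] by blast
  moreover have "finite (parcs G `` B x - B x)"
    using assms(2) by (auto simp: pair_graph_iff intro: finite_subset[of _ "pverts G"])
  ultimately have "max_degree H \<le> card (parcs G `` B x - B x)"
    unfolding x(2) by (metis card_image card_mono)
  then show ?thesis using that B(1) x(1) by blast
qed

text \<open>Contracting an edge inside \<open>S\<close> lowers both \<open>card (pverts G)\<close>
  and \<open>card S\<close> by one, so the inequality carries over from the smaller graph. The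
  induction stops at a single vertex adjacent to all others.\<close>

lemma connected_dominating_imp_minor:
  assumes "pair_graph G" "S \<subseteq> pverts G" "connected_set (parcs G) S"
    "pverts G \<subseteq> S \<union> parcs G `` S"
  shows "\<exists>H. has_minor G H \<and> card (pverts G) \<le> max_degree H + card S"
  using assms
proof (induction "card S" arbitrary: G S rule: less_induct)
  case less
  have G: "finite (pverts G)" "parcs G \<subseteq> pverts G \<times> pverts G" "irrefl (parcs G)"
    using less.prems(1) by (auto simp: pair_graph_iff)
  have finS: "finite S" using G(1) less.prems(2) finite_subset by blast
  obtain u where u: "u \<in> S" using less.prems(3) by (auto simp: connected_set_def)
  show ?case
  proof (cases "S = {u}")
    case True
    have "card (pverts G) \<le> card (insert u (parcs G `` {u}))"
      using less.prems(4) G(1,2) True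
      by (intro card_mono finite_subset[of "insert u (parcs G `` {u})" "insert u (pverts G)"]) auto
    also have "\<dots> \<le> out_degree (with_proj G) u + 1"
      unfolding out_degree_with_proj by (simp add: card_insert_le_m1)
    also have "out_degree (with_proj G) u \<le> max_degree G"
      using u less.prems(2) G(1) by (auto simp: max_degree_def)
    finally show ?thesis using True minor_refl by (intro exI[of _ G]) auto
  next
    case False
    then obtain a v where "a = u" "v \<in> S - {u}" "(a, v) \<in> parcs G"
      using connected_set_crossing[OF less.prems(3), of "{u}"] u by blast
    then have v: "v \<in> S" "u \<noteq> v" "(u, v) \<in> parcs G" by auto
    let ?G = "contract_edge G u v"
    let ?f = "\<lambda>x. if x = v then u else x"
    have verts: "pverts ?G = pverts G - {v}"
      and arcs: "parcs ?G = map_prod ?f ?f ` parcs G - Id"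
      by (auto simp: contract_edge_def Let_def)
    have "pverts ?G \<subseteq> (S - {v}) \<union> parcs ?G `` (S - {v})"
    proof
      fix w assume w: "w \<in> pverts ?G"
      show "w \<in> (S - {v}) \<union> parcs ?G `` (S - {v})"
      proof (cases "w \<in> S")
        case False
        then obtain s where s: "s \<in> S" "(s, w) \<in> parcs G"
          using w less.prems(4) verts by blast
        \<comment> \<open>If \<open>w\<close> was dominated by \<open>v\<close>, it is now dominated
          by \<open>u\<close>. The image arc is no loop because \<open>w\<close> lies outside
          \<open>S\<close>.\<close>
        have "(?f s, ?f w) \<in> map_prod ?f ?f ` parcs G"
          using s(2) by (intro rev_image_eqI[of "(s, w)"]) auto
        moreover have "?f w = w" "?f s \<in> S - {v}" using False s u v by auto
        ultimately have "(?f s, w) \<in> parcs ?G" "?f s \<in> S - {v}"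
          using False unfolding arcs by auto
        then show ?thesis by blast
      qed (use w verts in auto)
    qed
    moreover have "connected_set (parcs ?G) (S - {v})"
      unfolding arcs by (rule connected_set_contract[OF less.prems(3) u v(2)])
    moreover have "card (S - {v}) < card S"
      using v finS by (intro psubset_card_mono) auto
    ultimately obtain H where H: "has_minor ?G H" "card (pverts ?G) \<le> max_degree H + card (S - {v})"
      using less.hyps[of "S - {v}" ?G] pair_graph_contract_edge[OF less.prems(1) v(3)]
        less.prems(2) verts by blast
    have "has_minor G H"
      using has_minor_trans[OF H(1)] minor_contract_edge[OF minor_refl v(3)] by blast
    moreover have "card (pverts G) = Suc (card (pverts ?G))" "card S = Suc (card (S - {v}))"
      using v(1) less.prems(2) unfolding verts
      by (blast intro: card.remove[OF G(1)] card.remove[OF finS])+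
    ultimately show ?thesis using H(2) by auto
  qed
qed

section \<open>The two implications, for a single graph\<close>

lemma minor_imp_connected_domination_number:
  assumes "pair_graph G" "has_minor G H" "card (pverts G) \<le> max_degree H + k" "k \<ge> 1"
    "pverts G \<noteq> {}"
  shows "connected_domination_number G \<le> enat k \<or> connected_domination_number (complement G) \<le> enat k"
proof -
  have G: "finite (pverts G)" "parcs G \<subseteq> pverts G \<times> pverts G" "sym (parcs G)"
    using assms(1) by (auto simp: pair_graph_iff)
  obtain S where S: "S \<subseteq> pverts G" "connected_set (parcs G) S"
    "max_degree H \<le> card (parcs G `` S - S)"
    using has_minor_imp_connected_set[OF assms(2,1,5)] by blast
  have ne: "S' \<noteq> {}" if "connected_set r S'" for r and S' :: "'a set"
    using that by (simp add: connected_set_def)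
  \<comment> \<open>For disconnected graphs the dominating set of the complement has two vertices,
    so \<open>k = 1\<close> needs its own argument.\<close>
  consider (connected) "connected_set (parcs G) (pverts G)"
    | (one) "k = 1" | (disconnected) "\<not> connected_set (parcs G) (pverts G)" "k \<ge> 2"
    using assms(4) by linarith
  then show ?thesis
  proof cases
    case connected
    from connected_set_extend_dominating[OF G connected S(2,1)] obtain S'
      where S': "S' \<subseteq> pverts G" "connected_set (parcs G) S'" "pverts G \<subseteq> S' \<union> parcs G `` S'"
        "card (parcs G `` S - S) + card S' \<le> card (pverts G)" by blast
    then have "card S' \<le> k" using S(3) assms(3) by linarith
    then show ?thesis
      using S' connected_dominating_iff[OF assms(1) ne] unfolding connected_domination_number_le_iff by blast
  next
    case one
    let ?N = "parcs G `` S - S"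
    have fin: "finite S" "finite ?N" using S(1) G by (auto intro: finite_subset[of _ "pverts G"])
    have sub: "S \<union> ?N \<subseteq> pverts G" using S(1) G(2) by auto
    have card: "card (S \<union> ?N) = card S + card ?N" using fin by (intro card_Un_disjoint) auto
    moreover have "card S \<ge> 1" using ne[OF S(2)] fin by (simp add: Suc_leI card_gt_0_iff)
    moreover have "card (S \<union> ?N) \<le> card (pverts G)" using sub G(1) by (rule card_mono[rotated])
    \<comment> \<open>With at least \<open>card (pverts G) - 1\<close> outer neighbours and
      \<open>S\<close> nonempty, there is room only for a one-vertex \<open>S\<close>, and together
      they exhaust the graph.\<close>
    ultimately have "card (S \<union> ?N) = card (pverts G)" "card S \<le> k"
      using S(3) assms(3) one by linarith+
    then have "S \<union> ?N = pverts G" using card_subset_eq[OF G(1) sub] by blast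
    then have "connected_dominating G S"
      using S connected_dominating_iff[OF assms(1) ne[OF S(2)]] by blast
    then show ?thesis using \<open>card S \<le> k\<close> unfolding connected_domination_number_le_iff by blast
  next
    case disconnected
    obtain u v where uv: "u \<in> pverts G" "v \<in> pverts G"
      "connected_set (parcs (complement G)) {u, v}"
      "pverts G \<subseteq> {u, v} \<union> parcs (complement G) `` {u, v}"
      using connected_set_complement_pair[OF assms(1,5) disconnected(1)] by blast
    then have "connected_dominating (complement G) {u, v}"
      using connected_dominating_iff[OF pair_graph_complement[OF assms(1)], of "{u, v}"]
      by (simp add: complement_def)
    moreover have "card {u, v} \<le> k"
      using disconnected(2) card_insert_le_m1[of 2 "{v}" u] by simp
    ultimately show ?thesis unfolding connected_domination_number_le_iff by blast
  qed
qed

lemma connected_domination_number_imp_minor: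
  assumes "pair_graph G" "connected_domination_number G \<le> enat k"
  shows "\<exists>H. has_minor G H \<and> card (pverts G) \<le> max_degree H + k"
proof -
  obtain S where S: "connected_dominating G S" "card S \<le> k"
    using assms(2) by (auto simp: connected_domination_number_le_iff)
  show ?thesis
  proof (cases "S = {}")
    case True
    then have "pverts G = {}" using S(1) by (auto simp: connected_dominating_def dominating_def)
    then show ?thesis using minor_refl by auto
  next
    case False
    then obtain H where "has_minor G H" "card (pverts G) \<le> max_degree H + card S"
      using connected_dominating_imp_minor[OF assms(1)] S(1)
        connected_dominating_iff[OF assms(1) False] by blast
    then show ?thesis using S(2) by (intro exI[of _ H]) auto
  qed
qed

theorem theorem23:
  fixes G :: "'a pair_pre_digraph" and n k :: nat
  assumes "pair_graph G" and "card (pverts G) = n" and "k \<ge> 1"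
  shows "(\<exists>H. (has_minor G H \<or> has_minor (complement G) H) \<and> int (max_degree H) \<ge> int n - int k) \<longleftrightarrow>
    min (connected_domination_number G) (connected_domination_number (complement G)) \<le> enat k"
proof -
  let ?C = "complement G"
  have C: "pair_graph ?C" "pverts ?C = pverts G" "complement ?C = G"
    using assms(1) by (auto simp: pair_graph_complement complement_complement) (auto simp: complement_def)
  \<comment> \<open>The integer difference may be negative; the additive form over
    \<open>nat\<close> covers this case too.\<close>
  have iff: "int (max_degree H) \<ge> int n - int k \<longleftrightarrow> card (pverts G) \<le> max_degree H + k" for H :: "'a pair_pre_digraph"
    using assms(2) by linarith
  show ?thesis
  proof (cases "pverts G = {}")
    \<comment> \<open>For the graph without vertices both sides hold: the empty set is connected
      dominating, and \<open>G\<close> is a minor of itself.\<close>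
    case True
    then have "connected_dominating G {}" by (simp add: connected_dominating_def dominating_def)
    then have "connected_domination_number G \<le> enat k"
      unfolding connected_domination_number_le_iff by (intro exI[of _ "{}"]) simp
    then show ?thesis using True minor_refl[of G] by (auto simp: iff min_le_iff_disj)
  next
    case False
    then show ?thesis
      unfolding iff min_le_iff_disj
      \<comment> \<open>Each implication is used for \<open>G\<close> and for \<open>?C\<close>;
        since \<open>complement ?C = G\<close>, both uses speak of the same pair of graphs.\<close>
      using minor_imp_connected_domination_number[OF assms(1) _ _ assms(3)]
        minor_imp_connected_domination_number[OF C(1) _ _ assms(3)]
        connected_domination_number_imp_minor[OF assms(1)]
        connected_domination_number_imp_minor[OF C(1)]
      unfolding C by blast
  qed
qed

end
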